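(* Let $\tau>0$ be the time step, $t_n=t_0+n\tau$, and let $(a_{ij},b_i,c_i)_{i,j=1}^s$ be the coefficients of an $s$-stage symplectic Runge–Kutta method, i.e. $b_ia_{ij}+b_ja_{ji}=b_ib_j$ for all $i,j=1,\dots,s$. Consider the semi-discrete $s$-stage method which, for $n\ge1$, given $z^n\in V$, $e^n>0$ and the extrapolated values $z_{s,i}^n\in V$, $e_{s,i}^n\in\mathbb{R}$ (computed explicitly from the previous time step as described in the context), is defined by $$z_i^n=z^n+\tau\sum_{j=1}^sa_{ij}k_j^n,\quad k_i^n=\mathcal{D}\mu_i^n,\quad \mu_i^n=\mathcal{L}z_i^n+B(z_{s,i}^n,e_{s,i}^n),\qquad i=1,\dots,s,$$ $$e_i^n=\exp\Big(\ln(e^n)+\tau\sum_{j=1}^sa_{ij}l_j^n\Big),\quad l_i^n=\big(B(z_{s,i}^n,e_{s,i}^n),k_i^n\big),\qquad i=1,\dots,s,$$ $$z^{n+1}=z^n+\tau\sum_{i=1}^sb_ik_i^n,\qquad e^{n+1}=\exp\Big(\ln(e^n)+\tau\sum_{i=1}^sb_il_i^n\Big),$$ where $B(z,e)=\mathcal{N}'(z)\,e/\exp(\mathcal{H}_2(z))$. Then this method is linearly implicit and energy-preserving, with the discrete energy conservation law $$\tilde{\mathcal{H}}_s^{n+1}=\tilde{\mathcal{H}}_s^n,\qquad \tilde{\mathcal{H}}_s^n=\frac12\big(z^n,\mathcal{L}z^n\big)+\ln(e^n).$$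
   Context: Setting. $\Omega\subset\mathbb{R}^d$ is a spatial region with periodic boundary conditions, $(\cdot,\cdot)$ is the real $L^2$ inner product on $\Omega$, and $V$ is the space of sufficiently smooth real-valued (possibly vector-valued) periodic functions on $\Omega$. $\mathcal{D}:V\to V$ is a linear skew-adjoint operator, $(\mathcal{D}f,g)=-(f,\mathcal{D}g)$, independent of the solution $z$ and its derivatives. $\mathcal{L}:V\to V$ is a linear, symmetric, non-negative operator: $(\mathcal{L}f,g)=(f,\mathcal{L}g)$ and $(f,\mathcal{L}f)\ge 0$. The Hamiltonian PDE is $$z_t=\mathcal{D}\mu,\qquad \mu=\mathcal{L}z+\mathcal{N}'(z),\qquad \mathcal{H}(z)=\tfrac12(z,\mathcal{L}z)+\mathcal{H}_2(z),\qquad \mathcal{H}_2(z)=(\mathcal{N}(z),1),$$ where $\mathcal{N}(z)$ is a (smooth) energy density and $\mathcal{N}'(z)=\delta\mathcal{H}_2/\delta z$ is the variational derivative of $\mathcal{H}_2$. With the scalar auxiliary variable $e(t)=\exp(\mathcal{H}_2(z(\cdot,t)))>0$ the PDE is rewritten equivalently as $$z_t=\mathcal{D}\mu,\qquad \mu=\mathcal{L}z+B(z,e),\qquad \frac{d}{dt}\ln(e)=\big(B(z,e),z_t\big),$$ and the method in the claim is a time discretization of this system. Runge–Kutta coefficients: $a_{ij},b_i$ are real numbers and $c_i=\sum_{j=1}^sa_{ij}$; the numbers $0,c_1,\dots,c_s$ are distinct, so that the interpolation below makes sense. Extrapolated values: for $n\ge1$, $z_{s,i}^n$ is the value at time $t_n+c_i\tau$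 of the polynomial in time of degree at most $s$ interpolating the points $(t_{n-1},z^{n-1})$ and $(t_{n-1}+c_j\tau,z_j^{n-1})$, $j=1,\dots,s$; $e_{s,i}^n$ is obtained in the same way from $(t_{n-1},e^{n-1})$ and $(t_{n-1}+c_j\tau,e_j^{n-1})$. In the first step ($n=0$) the stages $z_i^0,e_i^0$ and $z^1,e^1$ are computed by the fully implicit Runge–Kutta method, i.e. the same formulas with $B(z_{s,i}^n,e_{s,i}^n)$ replaced by $B(z_i^0,e_i^0)$. Terminology. "Linearly implicit" means that at each step the only equations to be solved are linear equations for the stages $z_1^n,\dots,z_s^n$ with coefficient operators independent of the solution, after which $e_i^n$, $z^{n+1}$, $e^{n+1}$ are given explicitly. "Energy-preserving" means that the stated discrete energy conservation law holds for every solution of the scheme. *)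

theory Defs
  imports "HOL-Analysis.Analysis" "HOL-Library.Extended_Nat"
begin

primrec C_class :: "nat \<Rightarrow> ('a::euclidean_space \<Rightarrow> 'b::euclidean_space) \<Rightarrow> bool" where
  "C_class 0 f \<longleftrightarrow> continuous_on UNIV f"
| "C_class (Suc m) f \<longleftrightarrow> (\<forall>x. f differentiable at x) \<and>
     (\<forall>v. C_class m (\<lambda>x. frechet_derivative f (at x) v))"

text \<open>The spatial region is the cell \<open>cbox lo hi\<close>.  Functions satisfying the periodic boundary
  conditions are represented by their periodic extensions to the whole space.  The degree of
  smoothness \<open>k\<close> may be \<open>\<infinity>\<close>.\<close>

definition periodic_functions ::
  "enat \<Rightarrow> 'a::euclidean_space \<Rightarrow> 'a \<Rightarrow> ('a \<Rightarrow> 'b::euclidean_space) set" where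
  "periodic_functions k lo hi =
     {f. (\<forall>m. enat m \<le> k \<longrightarrow> C_class m f) \<and>
         (\<forall>i\<in>Basis. \<forall>x. f (x + ((hi - lo) \<bullet> i) *\<^sub>R i) = f x)}"

definition l2 ::
  "'a::euclidean_space \<Rightarrow> 'a \<Rightarrow> ('a \<Rightarrow> 'b::euclidean_space) \<Rightarrow> ('a \<Rightarrow> 'b) \<Rightarrow> real" where
  "l2 lo hi f g = integral (cbox lo hi) (\<lambda>x. f x \<bullet> g x)"

definition linear_operator_on ::
  "('a \<Rightarrow> 'b::real_vector) set \<Rightarrow> (('a \<Rightarrow> 'b) \<Rightarrow> ('a \<Rightarrow> 'b)) \<Rightarrow> bool" where
  "linear_operator_on V A \<longleftrightarrow>
     (\<forall>f\<in>V. A f \<in> V) \<and>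
     (\<forall>f\<in>V. \<forall>g\<in>V. A (\<lambda>x. f x + g x) = (\<lambda>x. A f x + A g x)) \<and>
     (\<forall>c. \<forall>f\<in>V. A (\<lambda>x. c *\<^sub>R f x) = (\<lambda>x. c *\<^sub>R A f x))"

definition skew_adjoint_on ::
  "('a::euclidean_space \<Rightarrow> 'b::euclidean_space) set \<Rightarrow> 'a \<Rightarrow> 'a \<Rightarrow>
    (('a \<Rightarrow> 'b) \<Rightarrow> ('a \<Rightarrow> 'b)) \<Rightarrow> bool" where
  "skew_adjoint_on V lo hi D \<longleftrightarrow> (\<forall>f\<in>V. \<forall>g\<in>V. l2 lo hi (D f) g = - l2 lo hi f (D g))"

definition symmetric_on ::
  "('a::euclidean_space \<Rightarrow> 'b::euclidean_space) set \<Rightarrow> 'a \<Rightarrow> 'a \<Rightarrow>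
    (('a \<Rightarrow> 'b) \<Rightarrow> ('a \<Rightarrow> 'b)) \<Rightarrow> bool" where
  "symmetric_on V lo hi L \<longleftrightarrow> (\<forall>f\<in>V. \<forall>g\<in>V. l2 lo hi (L f) g = l2 lo hi f (L g))"

definition nonnegative_on ::
  "('a::euclidean_space \<Rightarrow> 'b::euclidean_space) set \<Rightarrow> 'a \<Rightarrow> 'a \<Rightarrow>
    (('a \<Rightarrow> 'b) \<Rightarrow> ('a \<Rightarrow> 'b)) \<Rightarrow> bool" where
  "nonnegative_on V lo hi L \<longleftrightarrow> (\<forall>f\<in>V. 0 \<le> l2 lo hi f (L f))"

text \<open>The energy density is an operator \<open>N\<close> from functions to scalar functions, so that it may
  involve derivatives of its argument.\<close>

definition H2 ::
  "'a::euclidean_space \<Rightarrow> 'a \<Rightarrow> (('a \<Rightarrow> 'b) \<Rightarrow> ('a \<Rightarrow> real)) \<Rightarrow> ('a \<Rightarrow> 'b) \<Rightarrow> real" where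
  "H2 lo hi N z = l2 lo hi (N z) (\<lambda>_. 1)"

definition variational_derivative_on ::
  "('a::euclidean_space \<Rightarrow> 'b::euclidean_space) set \<Rightarrow> 'a \<Rightarrow> 'a \<Rightarrow>
    (('a \<Rightarrow> 'b) \<Rightarrow> real) \<Rightarrow> (('a \<Rightarrow> 'b) \<Rightarrow> ('a \<Rightarrow> 'b)) \<Rightarrow> bool" where
  "variational_derivative_on V lo hi H H' \<longleftrightarrow>
     (\<forall>z\<in>V. H' z \<in> V \<and>
       (\<forall>v\<in>V. ((\<lambda>\<epsilon>. H (\<lambda>x. z x + \<epsilon> *\<^sub>R v x)) has_real_derivative l2 lo hi (H' z) v) (at 0)))"

definition sav_B ::
  "'a::euclidean_space \<Rightarrow> 'a \<Rightarrow> (('a \<Rightarrow> 'b::euclidean_space) \<Rightarrow> ('a \<Rightarrow> real)) \<Rightarrow>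
    (('a \<Rightarrow> 'b) \<Rightarrow> ('a \<Rightarrow> 'b)) \<Rightarrow> ('a \<Rightarrow> 'b) \<Rightarrow> real \<Rightarrow> ('a \<Rightarrow> 'b)" where
  "sav_B lo hi N N' z e = (\<lambda>x. (e / exp (H2 lo hi N z)) *\<^sub>R N' z x)"

definition discrete_energy ::
  "'a::euclidean_space \<Rightarrow> 'a \<Rightarrow> (('a \<Rightarrow> 'b::euclidean_space) \<Rightarrow> ('a \<Rightarrow> 'b)) \<Rightarrow>
    ('a \<Rightarrow> 'b) \<Rightarrow> real \<Rightarrow> real" where
  "discrete_energy lo hi L z e = 1 / 2 * l2 lo hi z (L z) + ln e"

text \<open>Stages are numbered \<open>0, \<dots>, s - 1\<close>; coefficients and stage values with other indices are
  irrelevant.\<close>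

definition rk_c :: "nat \<Rightarrow> (nat \<Rightarrow> nat \<Rightarrow> real) \<Rightarrow> nat \<Rightarrow> real" where
  "rk_c s a i = (\<Sum>j<s. a i j)"

definition symplectic_rk :: "nat \<Rightarrow> (nat \<Rightarrow> nat \<Rightarrow> real) \<Rightarrow> (nat \<Rightarrow> real) \<Rightarrow> bool" where
  "symplectic_rk s a b \<longleftrightarrow> (\<forall>i<s. \<forall>j<s. b i * a i j + b j * a j i = b i * b j)"

text \<open>Value at \<open>t\<close> of the polynomial of degree at most \<open>s\<close> through the \<open>s + 1\<close> points
  \<open>(ts j, ys j)\<close>, \<open>j \<le> s\<close>.  It is meaningful only when the nodes \<open>ts 0, \<dots>, ts s\<close> are distinct.\<close>

definition interpolation_value ::
  "nat \<Rightarrow> (nat \<Rightarrow> real) \<Rightarrow> (nat \<Rightarrow> 'v::real_vector) \<Rightarrow> real \<Rightarrow> 'v" where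
  "interpolation_value s ts ys t =
     (THE v. \<exists>q. (\<forall>j\<le>s. (\<Sum>m\<le>s. ts j ^ m *\<^sub>R q m) = ys j) \<and> v = (\<Sum>m\<le>s. t ^ m *\<^sub>R q m))"

text \<open>In \<open>extrapolate s a \<tau> t y Y i\<close>, the step that starts at time \<open>t\<close> with value \<open>y\<close> and has the
  stage values \<open>Y\<close> is extrapolated to the \<open>i\<close>-th stage of the next step.\<close>

definition extrapolate ::
  "nat \<Rightarrow> (nat \<Rightarrow> nat \<Rightarrow> real) \<Rightarrow> real \<Rightarrow> real \<Rightarrow> 'v::real_vector \<Rightarrow> (nat \<Rightarrow> 'v) \<Rightarrow> nat \<Rightarrow> 'v" where
  "extrapolate s a \<tau> t y Y i =
     interpolation_value s (case_nat t (\<lambda>j. t + rk_c s a j * \<tau>)) (case_nat y Y)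
       (t + \<tau> + rk_c s a i * \<tau>)"

text \<open>One step from \<open>(z, e)\<close> to \<open>(z1, e1)\<close>.  \<open>B\<close> is evaluated at \<open>(zs i, es i)\<close>; the stage
  quantities are \<open>Z, E, K, M, l\<close> (\<open>M\<close> for \<open>\<mu>\<close>).\<close>

definition rk_step ::
  "('a::euclidean_space \<Rightarrow> 'b::euclidean_space) set \<Rightarrow> 'a \<Rightarrow> 'a \<Rightarrow>
    (('a \<Rightarrow> 'b) \<Rightarrow> ('a \<Rightarrow> 'b)) \<Rightarrow> (('a \<Rightarrow> 'b) \<Rightarrow> ('a \<Rightarrow> 'b)) \<Rightarrow>
    (('a \<Rightarrow> 'b) \<Rightarrow> real \<Rightarrow> ('a \<Rightarrow> 'b)) \<Rightarrow>
    nat \<Rightarrow> (nat \<Rightarrow> nat \<Rightarrow> real) \<Rightarrow> (nat \<Rightarrow> real) \<Rightarrow> real \<Rightarrow>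
    ('a \<Rightarrow> 'b) \<Rightarrow> real \<Rightarrow> (nat \<Rightarrow> 'a \<Rightarrow> 'b) \<Rightarrow> (nat \<Rightarrow> real) \<Rightarrow>
    (nat \<Rightarrow> 'a \<Rightarrow> 'b) \<Rightarrow> (nat \<Rightarrow> real) \<Rightarrow> (nat \<Rightarrow> 'a \<Rightarrow> 'b) \<Rightarrow> (nat \<Rightarrow> 'a \<Rightarrow> 'b) \<Rightarrow> (nat \<Rightarrow> real) \<Rightarrow>
    ('a \<Rightarrow> 'b) \<Rightarrow> real \<Rightarrow> bool" where
  "rk_step V lo hi D L B s a b \<tau> z e zs es Z E K M l z1 e1 \<longleftrightarrow>
     (\<forall>i<s. Z i \<in> V \<and>
        Z i = (\<lambda>x. z x + \<tau> *\<^sub>R (\<Sum>j<s. a i j *\<^sub>R K j x)) \<and>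
        K i = D (M i) \<and>
        M i = (\<lambda>x. L (Z i) x + B (zs i) (es i) x) \<and>
        E i = exp (ln e + \<tau> * (\<Sum>j<s. a i j * l j)) \<and>
        l i = l2 lo hi (B (zs i) (es i)) (K i)) \<and>
     z1 = (\<lambda>x. z x + \<tau> *\<^sub>R (\<Sum>i<s. b i *\<^sub>R K i x)) \<and>
     e1 = exp (ln e + \<tau> * (\<Sum>i<s. b i * l i))"

text \<open>A solution of the first \<open>T\<close> steps.  The first step is fully implicit: there \<open>B\<close> is evaluated
  at the stages of the same step.\<close>

definition scheme_solution ::
  "('a::euclidean_space \<Rightarrow> 'b::euclidean_space) set \<Rightarrow> 'a \<Rightarrow> 'a \<Rightarrow>
    (('a \<Rightarrow> 'b) \<Rightarrow> ('a \<Rightarrow> 'b)) \<Rightarrow> (('a \<Rightarrow> 'b) \<Rightarrow> ('a \<Rightarrow> 'b)) \<Rightarrow>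
    (('a \<Rightarrow> 'b) \<Rightarrow> real \<Rightarrow> ('a \<Rightarrow> 'b)) \<Rightarrow>
    nat \<Rightarrow> (nat \<Rightarrow> nat \<Rightarrow> real) \<Rightarrow> (nat \<Rightarrow> real) \<Rightarrow> real \<Rightarrow> real \<Rightarrow> nat \<Rightarrow>
    (nat \<Rightarrow> 'a \<Rightarrow> 'b) \<Rightarrow> (nat \<Rightarrow> real) \<Rightarrow>
    (nat \<Rightarrow> nat \<Rightarrow> 'a \<Rightarrow> 'b) \<Rightarrow> (nat \<Rightarrow> nat \<Rightarrow> real) \<Rightarrow>
    (nat \<Rightarrow> nat \<Rightarrow> 'a \<Rightarrow> 'b) \<Rightarrow> (nat \<Rightarrow> nat \<Rightarrow> 'a \<Rightarrow> 'b) \<Rightarrow> (nat \<Rightarrow> nat \<Rightarrow> real) \<Rightarrow> bool" where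
  "scheme_solution V lo hi D L B s a b \<tau> t0 T z e Z E K M l \<longleftrightarrow>
     z 0 \<in> V \<and> e 0 > 0 \<and>
     (\<forall>n<T. rk_step V lo hi D L B s a b \<tau> (z n) (e n)
        (if n = 0 then Z 0
         else (\<lambda>i x. extrapolate s a \<tau> (t0 + real (n - 1) * \<tau>) (z (n - 1) x) (\<lambda>j. Z (n - 1) j x) i))
        (if n = 0 then E 0
         else extrapolate s a \<tau> (t0 + real (n - 1) * \<tau>) (e (n - 1)) (E (n - 1)))
        (Z n) (E n) (K n) (M n) (l n) (z (Suc n)) (e (Suc n)))"

text \<open>Eliminating \<open>K\<close> and \<open>M\<close> from the stage equations gives a system
  \<open>\<Sum>\<^sub>j A\<^sub>i\<^sub>j z\<^sub>j = r\<^sub>i\<close> with the block operators \<open>A\<^sub>i\<^sub>j = \<delta>\<^sub>i\<^sub>j - \<tau> a\<^sub>i\<^sub>j D L\<close>; neither \<open>A\<close> nor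
  \<open>r\<close> depends on the unknown stages, and \<open>A\<close> does not depend on the known data of the step either.\<close>

definition stage_operator ::
  "(('a \<Rightarrow> 'b) \<Rightarrow> ('a \<Rightarrow> 'b)) \<Rightarrow> (('a \<Rightarrow> 'b) \<Rightarrow> ('a \<Rightarrow> 'b)) \<Rightarrow>
    (nat \<Rightarrow> nat \<Rightarrow> real) \<Rightarrow> real \<Rightarrow> nat \<Rightarrow> nat \<Rightarrow> ('a \<Rightarrow> 'b::real_vector) \<Rightarrow> ('a \<Rightarrow> 'b)" where
  "stage_operator D L a \<tau> i j f =
     (\<lambda>x. (if i = j then f x else 0) - (\<tau> * a i j) *\<^sub>R D (L f) x)"

definition stage_rhs ::
  "(('a \<Rightarrow> 'b) \<Rightarrow> ('a \<Rightarrow> 'b)) \<Rightarrow> (('a \<Rightarrow> 'b) \<Rightarrow> real \<Rightarrow> ('a \<Rightarrow> 'b)) \<Rightarrow>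
    nat \<Rightarrow> (nat \<Rightarrow> nat \<Rightarrow> real) \<Rightarrow> real \<Rightarrow>
    ('a \<Rightarrow> 'b::real_vector) \<Rightarrow> (nat \<Rightarrow> 'a \<Rightarrow> 'b) \<Rightarrow> (nat \<Rightarrow> real) \<Rightarrow> nat \<Rightarrow> ('a \<Rightarrow> 'b)" where
  "stage_rhs D B s a \<tau> z zs es i =
     (\<lambda>x. z x + \<tau> *\<^sub>R (\<Sum>j<s. a i j *\<^sub>R D (B (zs j) (es j)) x))"

definition explicit_M ::
  "(('a \<Rightarrow> 'b) \<Rightarrow> ('a \<Rightarrow> 'b)) \<Rightarrow> (('a \<Rightarrow> 'b) \<Rightarrow> real \<Rightarrow> ('a \<Rightarrow> 'b)) \<Rightarrow>
    (nat \<Rightarrow> 'a \<Rightarrow> 'b::real_vector) \<Rightarrow> (nat \<Rightarrow> real) \<Rightarrow> (nat \<Rightarrow> 'a \<Rightarrow> 'b) \<Rightarrow> nat \<Rightarrow> ('a \<Rightarrow> 'b)" where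
  "explicit_M L B zs es Z i = (\<lambda>x. L (Z i) x + B (zs i) (es i) x)"

definition explicit_K ::
  "(('a \<Rightarrow> 'b) \<Rightarrow> ('a \<Rightarrow> 'b)) \<Rightarrow> (('a \<Rightarrow> 'b) \<Rightarrow> ('a \<Rightarrow> 'b)) \<Rightarrow>
    (('a \<Rightarrow> 'b) \<Rightarrow> real \<Rightarrow> ('a \<Rightarrow> 'b)) \<Rightarrow>
    (nat \<Rightarrow> 'a \<Rightarrow> 'b::real_vector) \<Rightarrow> (nat \<Rightarrow> real) \<Rightarrow> (nat \<Rightarrow> 'a \<Rightarrow> 'b) \<Rightarrow> nat \<Rightarrow> ('a \<Rightarrow> 'b)" where
  "explicit_K D L B zs es Z i = D (explicit_M L B zs es Z i)"

definition explicit_l ::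
  "'a::euclidean_space \<Rightarrow> 'a \<Rightarrow> (('a \<Rightarrow> 'b) \<Rightarrow> ('a \<Rightarrow> 'b)) \<Rightarrow> (('a \<Rightarrow> 'b) \<Rightarrow> ('a \<Rightarrow> 'b)) \<Rightarrow>
    (('a \<Rightarrow> 'b) \<Rightarrow> real \<Rightarrow> ('a \<Rightarrow> 'b)) \<Rightarrow>
    (nat \<Rightarrow> 'a \<Rightarrow> 'b::euclidean_space) \<Rightarrow> (nat \<Rightarrow> real) \<Rightarrow> (nat \<Rightarrow> 'a \<Rightarrow> 'b) \<Rightarrow> nat \<Rightarrow> real" where
  "explicit_l lo hi D L B zs es Z i = l2 lo hi (B (zs i) (es i)) (explicit_K D L B zs es Z i)"

text \<open>One step amounts to solving linear equations for the stages \<open>Z\<close>, with coefficient operators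
  independent of all solution data, followed by explicit evaluations.\<close>

definition linearly_implicit ::
  "('a::euclidean_space \<Rightarrow> 'b::euclidean_space) set \<Rightarrow> 'a \<Rightarrow> 'a \<Rightarrow>
    (('a \<Rightarrow> 'b) \<Rightarrow> ('a \<Rightarrow> 'b)) \<Rightarrow> (('a \<Rightarrow> 'b) \<Rightarrow> ('a \<Rightarrow> 'b)) \<Rightarrow>
    (('a \<Rightarrow> 'b) \<Rightarrow> real \<Rightarrow> ('a \<Rightarrow> 'b)) \<Rightarrow>
    nat \<Rightarrow> (nat \<Rightarrow> nat \<Rightarrow> real) \<Rightarrow> (nat \<Rightarrow> real) \<Rightarrow> real \<Rightarrow> bool" where
  "linearly_implicit V lo hi D L B s a b \<tau> \<longleftrightarrow>
     (\<forall>i<s. \<forall>j<s. linear_operator_on V (stage_operator D L a \<tau> i j)) \<and>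
     (\<forall>z\<in>V. \<forall>e>0. \<forall>zs es. (\<forall>i<s. zs i \<in> V) \<longrightarrow>
        (\<forall>i<s. stage_rhs D B s a \<tau> z zs es i \<in> V) \<and>
        (\<forall>Z E K M l z1 e1.
           rk_step V lo hi D L B s a b \<tau> z e zs es Z E K M l z1 e1 \<longleftrightarrow>
           (\<forall>i<s. Z i \<in> V) \<and>
           (\<forall>i<s. (\<lambda>x. \<Sum>j<s. stage_operator D L a \<tau> i j (Z j) x)
                  = stage_rhs D B s a \<tau> z zs es i) \<and>
           (\<forall>i<s. M i = explicit_M L B zs es Z i \<and>
                  K i = explicit_K D L B zs es Z i \<and>
                  l i = explicit_l lo hi D L B zs es Z i \<and>
                  E i = exp (ln e + \<tau> * (\<Sum>j<s. a i j * explicit_l lo hi D L B zs es Z j))) \<and>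
           z1 = (\<lambda>x. z x + \<tau> *\<^sub>R (\<Sum>i<s. b i *\<^sub>R explicit_K D L B zs es Z i x)) \<and>
           e1 = exp (ln e + \<tau> * (\<Sum>i<s. b i * explicit_l lo hi D L B zs es Z i))))"

end

theory Submission
  imports Defs "HOL-Computational_Algebra.Polynomial"
begin

text \<open>
  Each step conserves the energy because the same values \<open>B\<^sub>i\<close> of the nonlinear term drive both
  the slopes \<open>k\<^sub>i\<close> of \<open>z\<close> and the slopes \<open>l\<^sub>i\<close> of \<open>ln e\<close>.  Write \<open>Q f g = (f, L g)\<close>.
  A symplectic Runge--Kutta method propagates the symmetric form \<open>Q\<close> without quadrature
  error, so that
  \<open>Q z\<^sup>n\<^sup>+\<^sup>1 z\<^sup>n\<^sup>+\<^sup>1 - Q z\<^sup>n z\<^sup>n = 2 \<tau> \<Sum>\<^sub>i b\<^sub>i (k\<^sub>i, L z\<^sub>i)\<close>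
  (\<open>symplectic_rk_quadratic_form\<close>).  Skew-adjointness of \<open>D\<close> gives
  \<open>(k\<^sub>i, L z\<^sub>i + B\<^sub>i) = (D \<mu>\<^sub>i, \<mu>\<^sub>i) = 0\<close>, that is \<open>(k\<^sub>i, L z\<^sub>i) = - l\<^sub>i\<close>.  The logarithm of the scalar
  variable satisfies \<open>ln e\<^sup>n\<^sup>+\<^sup>1 - ln e\<^sup>n = \<tau> \<Sum>\<^sub>i b\<^sub>i l\<^sub>i\<close>, with the same weights and slopes, and the two
  contributions cancel (\<open>rk_step_preserves_energy\<close>).

  The form \<open>(\<cdot>, \<cdot>)\<close> is bilinear only where the integrals exist, and skew-adjointness and
  linearity hold only on \<open>V\<close>.  Hence all functions involved must be shown to lie in \<open>V\<close>: it is
  closed under linear combinations, and an extrapolated value is a linear combination of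
  values of the previous step whose coefficients, the Lagrange weights, do not depend on the
  point in space (\<open>extrapolate_in_subspace\<close>).

  Linear implicitness is the elimination of \<open>k\<^sub>i\<close> and \<open>\<mu>\<^sub>i\<close> from the stage equations: since \<open>D\<close> is linear,
  \<open>k\<^sub>j = D L z\<^sub>j + D B\<^sub>j\<close>, and the first summand moves to the left-hand side
  (\<open>stage_equation_iff\<close>).
\<close>

section \<open>Spaces of periodic functions\<close>

definition function_subspace :: "('a \<Rightarrow> 'b::real_vector) set \<Rightarrow> bool" where
  "function_subspace V \<longleftrightarrow>
     (\<lambda>_. 0) \<in> V \<and> (\<forall>f\<in>V. \<forall>g\<in>V. \<forall>c. (\<lambda>x. f x + c *\<^sub>R g x) \<in> V)"

lemma function_subspace_zero: "function_subspace V \<Longrightarrow> (\<lambda>_. 0) \<in> V"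
  by (simp add: function_subspace_def)

lemma function_subspace_add_scale:
  "function_subspace V \<Longrightarrow> f \<in> V \<Longrightarrow> g \<in> V \<Longrightarrow> (\<lambda>x. f x + c *\<^sub>R g x) \<in> V"
  by (simp add: function_subspace_def)

lemma function_subspace_add:
  "function_subspace V \<Longrightarrow> f \<in> V \<Longrightarrow> g \<in> V \<Longrightarrow> (\<lambda>x. f x + g x) \<in> V"
  using function_subspace_add_scale[of V f g 1] by simp

lemma function_subspace_scale:
  "function_subspace V \<Longrightarrow> f \<in> V \<Longrightarrow> (\<lambda>x. c *\<^sub>R f x) \<in> V"
  using function_subspace_add_scale[of V "\<lambda>_. 0" f c] by (simp add: function_subspace_zero)

lemma function_subspace_sum:
  assumes "function_subspace V" and "finite I" and "\<And>i. i \<in> I \<Longrightarrow> g i \<in> V"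
  shows "(\<lambda>x. \<Sum>i\<in>I. c i *\<^sub>R g i x) \<in> V"
  using assms(2,3)
proof (induction I rule: finite_induct)
  case empty
  show ?case using assms(1) by (simp add: function_subspace_zero)
next
  case (insert i I)
  have "(\<lambda>x. (\<Sum>i\<in>I. c i *\<^sub>R g i x) + c i *\<^sub>R g i x) \<in> V"
    using insert by (intro function_subspace_add_scale[OF assms(1)]) auto
  then show ?case using insert.hyps by (simp add: add.commute)
qed

lemma C_class_zero: "C_class m (\<lambda>_. 0)"
proof (induction m)
  case (Suc m)
  then show ?case by (simp add: frechet_derivative_const)
qed simp

text \<open>Both the induction hypothesis and the differentiability clause survive because the Frechet
  derivative is itself linear in the function; the derivatives of \<open>f\<close> and \<open>g\<close> therefore form
  again a combination \<open>f' + c g'\<close> of two functions one class lower.\<close>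

lemma C_class_add_scale:
  "C_class m f \<Longrightarrow> C_class m g \<Longrightarrow> C_class m (\<lambda>x. f x + c *\<^sub>R g x)"
proof (induction m arbitrary: f g)
  case 0
  then show ?case by (auto intro!: continuous_intros)
next
  case (Suc m)
  have "((\<lambda>x. f x + c *\<^sub>R g x) has_derivative
      (\<lambda>v. frechet_derivative f (at x) v + c *\<^sub>R frechet_derivative g (at x) v)) (at x)" for x
    using Suc.prems
    by (intro has_derivative_add has_derivative_scaleR_right) (simp_all flip: frechet_derivative_works)
  from frechet_derivative_at[OF this]
  have "frechet_derivative (\<lambda>x. f x + c *\<^sub>R g x) (at x) v =
      frechet_derivative f (at x) v + c *\<^sub>R frechet_derivative g (at x) v" for x v
    by metis
  moreover have "(\<lambda>x. f x + c *\<^sub>R g x) differentiable at x" for x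
    using Suc.prems by (auto intro: differentiable_add differentiable_scaleR)
  ultimately show ?case using Suc by simp
qed

lemma function_subspace_periodic_functions: "function_subspace (periodic_functions k lo hi)"
  by (auto simp: function_subspace_def periodic_functions_def C_class_zero C_class_add_scale)

lemma continuous_periodic_functions:
  "f \<in> periodic_functions k lo hi \<Longrightarrow> continuous_on UNIV f"
  by (auto simp: periodic_functions_def dest: spec[of _ 0] simp flip: zero_enat_def)

section \<open>Bilinearity\<close>

lemma l2_commute: "l2 lo hi f g = l2 lo hi g f"
  by (simp add: l2_def inner_commute)

lemma l2_add_scale_left:
  assumes "continuous_on UNIV f" "continuous_on UNIV g" "continuous_on UNIV h"
  shows "l2 lo hi (\<lambda>x. f x + c *\<^sub>R g x) h = l2 lo hi f h + c * l2 lo hi g h"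
proof -
  have "(\<lambda>x. u x \<bullet> h x) integrable_on cbox lo hi" if "continuous_on UNIV u" for u
    using that assms(3)
    by (intro integrable_continuous continuous_on_inner) (auto intro: continuous_on_subset)
  then have "(\<lambda>x. f x \<bullet> h x) integrable_on cbox lo hi" "(\<lambda>x. g x \<bullet> h x) integrable_on cbox lo hi"
    using assms(1,2) by blast+
  then show ?thesis
    by (simp add: l2_def inner_add_left integral_add integrable_on_mult_right)
qed

text \<open>The combination has the form of a Runge--Kutta update.  The lemma is applied to
  \<open>\<phi> f = Q f h\<close> with \<open>h\<close> fixed, where \<open>Q\<close> is bilinear only on \<open>V\<close>.\<close>

lemma linear_functional_lincomb:
  fixes \<phi> :: "('a \<Rightarrow> 'b::real_vector) \<Rightarrow> real" and n :: nat
  assumes V: "function_subspace V"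
    and \<phi>: "\<And>f g c. f \<in> V \<Longrightarrow> g \<in> V \<Longrightarrow> \<phi> (\<lambda>x. f x + c *\<^sub>R g x) = \<phi> f + c * \<phi> g"
    and f: "f \<in> V" and g: "\<And>i. i < n \<Longrightarrow> g i \<in> V"
  shows "\<phi> (\<lambda>x. f x + \<tau> *\<^sub>R (\<Sum>i<n. c i *\<^sub>R g i x)) = \<phi> f + \<tau> * (\<Sum>i<n. c i * \<phi> (g i))"
proof -
  have "\<phi> (\<lambda>_. 0) = 0"
    using \<phi>[OF function_subspace_zero[OF V] function_subspace_zero[OF V], of 1] by simp
  moreover have "\<phi> (\<lambda>x. \<Sum>i<m. c i *\<^sub>R g i x) = \<phi> (\<lambda>_. 0) + (\<Sum>i<m. c i * \<phi> (g i))" if "m \<le> n" for m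
    using that
  proof (induction m)
    case (Suc m)
    then show ?case
      using \<phi>[OF function_subspace_sum[OF V, of "{..<m}" g c] g, of m "c m"] g
      by simp
  qed simp
  ultimately show ?thesis
    using \<phi>[OF f function_subspace_sum[OF V, of "{..<n}" g c], of \<tau>] g by simp
qed

section \<open>Polynomial extrapolation\<close>

definition lagrange_basis :: "nat \<Rightarrow> (nat \<Rightarrow> real) \<Rightarrow> nat \<Rightarrow> real poly" where
  "lagrange_basis s ts j = (\<Prod>i\<in>{..s} - {j}. smult (1 / (ts j - ts i)) [:- ts i, 1:])"

lemma degree_lagrange_basis:
  assumes "j \<le> s"
  shows "degree (lagrange_basis s ts j) \<le> s"
proof -
  have "degree (lagrange_basis s ts j) \<le>
      (\<Sum>i\<in>{..s} - {j}. degree (smult (1 / (ts j - ts i)) [:- ts i, 1:]))"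
    unfolding lagrange_basis_def by (rule degree_prod_sum_le[unfolded o_def]) simp
  also have "\<dots> \<le> (\<Sum>i\<in>{..s} - {j}. 1)"
    by (intro sum_mono order_trans[OF degree_smult_le]) simp
  also have "\<dots> = s"
    using assms by simp
  finally show ?thesis .
qed

lemma poly_lagrange_basis_node:
  assumes "inj_on ts {..s}" "j \<le> s" "i \<le> s"
  shows "poly (lagrange_basis s ts j) (ts i) = (if i = j then 1 else 0)"
proof (cases "i = j")
  case True
  have "poly (lagrange_basis s ts j) (ts j) = (\<Prod>i\<in>{..s} - {j}. 1)"
    unfolding lagrange_basis_def poly_prod
  proof (rule prod.cong)
    fix k assume "k \<in> {..s} - {j}"
    then have "ts j \<noteq> ts k" using assms by (auto dest: inj_onD)
    then show "poly (smult (1 / (ts j - ts k)) [:- ts k, 1:]) (ts j) = 1"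
      by (simp flip: diff_divide_distrib)
  qed simp
  then show ?thesis using True by simp
next
  case False
  then have "i \<in> {..s} - {j}" using assms by simp
  then have "poly (lagrange_basis s ts j) (ts i) = 0"
    unfolding lagrange_basis_def poly_prod by (intro prod_zero bexI[of _ i]) auto
  then show ?thesis using False by simp
qed

text \<open>Interpolating \<open>x\<^sup>m\<close> with \<open>m \<le> s\<close> at \<open>s + 1\<close> nodes returns \<open>x\<^sup>m\<close>: two polynomials of degree at
  most \<open>s\<close> that agree at \<open>s + 1\<close> points are equal.\<close>

lemma lagrange_basis_reproduces_powers:
  assumes "inj_on ts {..s}" "m \<le> s"
  shows "(\<Sum>j\<le>s. poly (lagrange_basis s ts j) t * ts j ^ m) = t ^ m"
proof -
  let ?p = "\<Sum>j\<le>s. smult (ts j ^ m) (lagrange_basis s ts j)"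
  have "?p = monom 1 m"
  proof (rule poly_eqI_degree[of "ts ` {..s}"])
    fix x assume "x \<in> ts ` {..s}"
    then obtain i where i: "i \<le> s" "x = ts i" by auto
    have "poly ?p x = (\<Sum>j\<le>s. ts j ^ m * (if i = j then 1 else 0))"
      unfolding poly_sum i(2)
      by (intro sum.cong) (use poly_lagrange_basis_node[OF assms(1) _ i(1)] in auto)
    also have "\<dots> = x ^ m"
      using i by (simp add: if_distrib sum.delta cong: if_cong)
    finally show "poly ?p x = poly (monom 1 m) x" by (simp add: poly_monom)
  next
    have "card (ts ` {..s}) = Suc s" using assms(1) by (simp add: card_image)
    moreover have "degree ?p \<le> s"
      by (intro degree_sum_le) (auto intro: order_trans[OF degree_smult_le] degree_lagrange_basis)
    moreover have "degree (monom (1::real) m) \<le> s"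
      using assms(2) by (simp add: degree_monom_eq)
    ultimately show "card (ts ` {..s}) > degree ?p" "card (ts ` {..s}) > degree (monom (1::real) m)"
      by simp_all
  qed
  then have "poly ?p t = t ^ m" by (simp add: poly_monom)
  then show ?thesis by (simp add: poly_sum mult.commute)
qed

text \<open>The data lie in an arbitrary real vector space, where the argument by counting roots is not
  available.  Existence of an interpolating polynomial comes from the coefficients of the real
  Lagrange polynomials.  Uniqueness of its value at \<open>t\<close> follows from the reproduction of powers,
  which turns \<open>\<Sum>\<^sub>j \<ell>\<^sub>j(t) \<Sum>\<^sub>m ts\<^sub>j\<^sup>m q\<^sub>m\<close> into \<open>\<Sum>\<^sub>m t\<^sup>m q\<^sub>m\<close>, whatever the coefficients \<open>q\<^sub>m\<close> are.\<close>

lemma interpolation_value_lagrange: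
  fixes ys :: "nat \<Rightarrow> 'v::real_vector"
  assumes inj: "inj_on ts {..s}"
  shows "interpolation_value s ts ys t = (\<Sum>j\<le>s. poly (lagrange_basis s ts j) t *\<^sub>R ys j)"
    (is "_ = ?v")
  unfolding interpolation_value_def
proof (rule the_equality)
  define q where "q m = (\<Sum>j\<le>s. coeff (lagrange_basis s ts j) m *\<^sub>R ys j)" for m
  have q: "(\<Sum>m\<le>s. x ^ m *\<^sub>R q m) = (\<Sum>j\<le>s. poly (lagrange_basis s ts j) x *\<^sub>R ys j)" for x
  proof -
    have "(\<Sum>m\<le>s. x ^ m *\<^sub>R q m) =
        (\<Sum>j\<le>s. \<Sum>m\<le>s. (x ^ m * coeff (lagrange_basis s ts j) m) *\<^sub>R ys j)"
      unfolding q_def scaleR_sum_right scaleR_scaleR by (rule sum.swap)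
    also have "\<dots> = (\<Sum>j\<le>s. poly (lagrange_basis s ts j) x *\<^sub>R ys j)"
    proof (intro sum.cong refl)
      fix j assume "j \<in> {..s}"
      then have "poly (lagrange_basis s ts j) x = (\<Sum>m\<le>s. coeff (lagrange_basis s ts j) m * x ^ m)"
        unfolding poly_altdef
        by (intro sum.mono_neutral_left) (auto intro: order_trans degree_lagrange_basis coeff_eq_0)
      then show "(\<Sum>m\<le>s. (x ^ m * coeff (lagrange_basis s ts j) m) *\<^sub>R ys j) =
          poly (lagrange_basis s ts j) x *\<^sub>R ys j"
        by (simp add: scaleR_sum_left mult.commute)
    qed
    finally show ?thesis .
  qed
  have "(\<Sum>m\<le>s. ts i ^ m *\<^sub>R q m) = ys i" if "i \<le> s" for i
  proof -
    have "(\<Sum>m\<le>s. ts i ^ m *\<^sub>R q m) = (\<Sum>j\<le>s. if i = j then ys j else 0)"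
      unfolding q by (intro sum.cong refl) (use poly_lagrange_basis_node[OF inj _ that] in auto)
    also have "\<dots> = ys i" using that by simp
    finally show ?thesis .
  qed
  then show "\<exists>q. (\<forall>j\<le>s. (\<Sum>m\<le>s. ts j ^ m *\<^sub>R q m) = ys j) \<and> ?v = (\<Sum>m\<le>s. t ^ m *\<^sub>R q m)"
    using q[of t] by (intro exI[of _ q]) auto
next
  fix v
  assume "\<exists>q. (\<forall>j\<le>s. (\<Sum>m\<le>s. ts j ^ m *\<^sub>R q m) = ys j) \<and> v = (\<Sum>m\<le>s. t ^ m *\<^sub>R q m)"
  then obtain q where q: "\<And>j. j \<le> s \<Longrightarrow> (\<Sum>m\<le>s. ts j ^ m *\<^sub>R q m) = ys j"
    and v: "v = (\<Sum>m\<le>s. t ^ m *\<^sub>R q m)" by auto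
  have "?v = (\<Sum>j\<le>s. \<Sum>m\<le>s. (poly (lagrange_basis s ts j) t * ts j ^ m) *\<^sub>R q m)"
    by (intro sum.cong refl) (simp add: q[symmetric] scaleR_sum_right)
  also have "\<dots> = (\<Sum>m\<le>s. (\<Sum>j\<le>s. poly (lagrange_basis s ts j) t * ts j ^ m) *\<^sub>R q m)"
    unfolding scaleR_sum_left by (rule sum.swap)
  also have "\<dots> = v"
    unfolding v by (intro sum.cong refl) (simp add: lagrange_basis_reproduces_powers[OF inj])
  finally show "v = ?v" by simp
qed

text \<open>Although the extrapolation is performed separately at each \<open>x\<close>, the Lagrange weights depend
  on the times only, so the result is one linear combination of the functions \<open>z\<close> and \<open>Z j\<close>.  The
  assumptions on \<open>\<tau>\<close> and on the abscissae make the interpolation times distinct.\<close>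

lemma extrapolate_in_subspace:
  assumes V: "function_subspace V" and "\<tau> > 0"
    and nodes: "inj_on (rk_c s a) {..<s}" "\<forall>i<s. rk_c s a i \<noteq> 0"
    and z: "z \<in> V" and Z: "\<And>j. j < s \<Longrightarrow> Z j \<in> V"
  shows "(\<lambda>x. extrapolate s a \<tau> t (z x) (\<lambda>j. Z j x) i) \<in> V"
proof -
  define ts where "ts = case_nat t (\<lambda>j. t + rk_c s a j * \<tau>)"
  have "ts i = ts j \<longrightarrow> i = j" if "i \<le> s" "j \<le> s" for i j
    using that nodes \<open>\<tau> > 0\<close>
    by (auto simp: ts_def Suc_le_eq split: nat.splits dest: inj_onD)
  then have inj: "inj_on ts {..s}" by (auto simp: inj_on_def)
  have "(\<lambda>x. extrapolate s a \<tau> t (z x) (\<lambda>j. Z j x) i) =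
      (\<lambda>x. \<Sum>j\<le>s. poly (lagrange_basis s ts j) (t + \<tau> + rk_c s a i * \<tau>) *\<^sub>R case_nat z Z j x)"
    unfolding extrapolate_def ts_def[symmetric] interpolation_value_lagrange[OF inj]
    by (intro ext sum.cong refl) (simp split: nat.split)
  also have "\<dots> \<in> V"
    using z Z by (intro function_subspace_sum[OF V]) (auto split: nat.split)
  finally show ?thesis .
qed

section \<open>Conservation of quadratic forms by symplectic methods\<close>

text \<open>Against a symmetric matrix only the symmetric part of \<open>b\<^sub>i a\<^sub>i\<^sub>j\<close> counts, and the symplecticity
  condition says that this part is \<open>b\<^sub>i b\<^sub>j / 2\<close>.\<close>

lemma symplectic_double_sum:
  assumes "symplectic_rk s a b" and sym: "\<And>i j. i < s \<Longrightarrow> j < s \<Longrightarrow> m i j = (m j i :: real)"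
  shows "2 * (\<Sum>i<s. \<Sum>j<s. b i * a i j * m i j) = (\<Sum>i<s. \<Sum>j<s. b i * b j * m i j)"
proof -
  have "(\<Sum>i<s. \<Sum>j<s. b i * a i j * m i j) = (\<Sum>i<s. \<Sum>j<s. b j * a j i * m i j)"
    by (subst sum.swap) (intro sum.cong refl, use sym in auto)
  then have "2 * (\<Sum>i<s. \<Sum>j<s. b i * a i j * m i j) =
      (\<Sum>i<s. \<Sum>j<s. b i * a i j * m i j) + (\<Sum>i<s. \<Sum>j<s. b j * a j i * m i j)"
    by simp
  also have "\<dots> = (\<Sum>i<s. \<Sum>j<s. (b i * a i j + b j * a j i) * m i j)"
    by (simp only: sum.distrib distrib_right)
  also have "\<dots> = (\<Sum>i<s. \<Sum>j<s. b i * b j * m i j)"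
    using assms(1) by (intro sum.cong refl) (simp add: symplectic_rk_def)
  finally show ?thesis .
qed

text \<open>The increment of the form is \<open>2 \<tau> \<Sum>\<^sub>i b\<^sub>i Q k\<^sub>i z + \<tau>\<^sup>2 \<Sum>\<^sub>i\<^sub>j b\<^sub>i b\<^sub>j Q k\<^sub>i k\<^sub>j\<close>.  Replacing \<open>z\<close> by
  \<open>Z i - \<tau> \<Sum>\<^sub>j a\<^sub>i\<^sub>j k\<^sub>j\<close> in the first sum yields \<open>- 2 \<tau>\<^sup>2 \<Sum>\<^sub>i\<^sub>j b\<^sub>i a\<^sub>i\<^sub>j Q k\<^sub>i k\<^sub>j\<close>, which cancels the second
  one by symplecticity.\<close>

lemma symplectic_rk_quadratic_form:
  fixes Q :: "('a \<Rightarrow> 'b::real_vector) \<Rightarrow> ('a \<Rightarrow> 'b) \<Rightarrow> real"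
  assumes V: "function_subspace V" and symplectic: "symplectic_rk s a b"
    and sym: "\<And>f g. f \<in> V \<Longrightarrow> g \<in> V \<Longrightarrow> Q f g = Q g f"
    and lin: "\<And>f g h c. f \<in> V \<Longrightarrow> g \<in> V \<Longrightarrow> h \<in> V \<Longrightarrow>
      Q (\<lambda>x. f x + c *\<^sub>R g x) h = Q f h + c * Q g h"
    and z: "z \<in> V" and K: "\<And>i. i < s \<Longrightarrow> K i \<in> V" and ZV: "\<And>i. i < s \<Longrightarrow> Z i \<in> V"
    and Z: "\<And>i. i < s \<Longrightarrow> Z i = (\<lambda>x. z x + \<tau> *\<^sub>R (\<Sum>j<s. a i j *\<^sub>R K j x))"
    and z1: "z1 = (\<lambda>x. z x + \<tau> *\<^sub>R (\<Sum>i<s. b i *\<^sub>R K i x))"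
  shows "Q z1 z1 = Q z z + 2 * \<tau> * (\<Sum>i<s. b i * Q (K i) (Z i))"
proof -
  have expand: "Q (\<lambda>x. z x + \<tau> *\<^sub>R (\<Sum>i<s. c i *\<^sub>R K i x)) h = Q z h + \<tau> * (\<Sum>i<s. c i * Q (K i) h)"
    if "h \<in> V" for c h
    by (rule linear_functional_lincomb[OF V, where \<phi> = "\<lambda>f. Q f h"]) (use lin that z K in auto)
  have z1V: "z1 \<in> V"
    unfolding z1 by (intro function_subspace_add_scale[OF V] function_subspace_sum[OF V] z K) auto
  have Q_z1: "Q h z1 = Q h z + \<tau> * (\<Sum>j<s. b j * Q (K j) h)" if "h \<in> V" for h
    using expand[OF that, of b] sym[OF that z1V] sym[OF that z] by (simp add: z1)
  have Q_Z: "Q (K i) (Z i) = Q (K i) z + \<tau> * (\<Sum>j<s. a i j * Q (K i) (K j))" if "i < s" for i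
  proof -
    have "Q (K i) (Z i) = Q z (K i) + \<tau> * (\<Sum>j<s. a i j * Q (K j) (K i))"
      using expand[OF K[OF that], of "a i"] sym[OF K[OF that] ZV[OF that]] Z[OF that] by simp
    also have "\<dots> = Q (K i) z + \<tau> * (\<Sum>j<s. a i j * Q (K i) (K j))"
      using that K z sym by (intro arg_cong2[of _ _ _ _ "(+)"] arg_cong2[of _ _ _ _ "(*)"] sum.cong) auto
    finally show ?thesis .
  qed
  let ?S = "\<Sum>i<s. \<Sum>j<s. b i * b j * Q (K i) (K j)"
  have "Q z1 z1 = Q z z1 + \<tau> * (\<Sum>i<s. b i * Q (K i) z1)"
    using expand[OF z1V, of b] by (simp add: z1)
  also have "Q z z1 = Q z z + \<tau> * (\<Sum>i<s. b i * Q (K i) z)"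
    by (rule Q_z1[OF z])
  also have "(\<Sum>i<s. b i * Q (K i) z1) =
      (\<Sum>i<s. b i * (Q (K i) z + \<tau> * (\<Sum>j<s. b j * Q (K i) (K j))))"
    using K sym by (intro sum.cong refl) (simp add: Q_z1)
  also have "\<dots> = (\<Sum>i<s. b i * Q (K i) z) + \<tau> * ?S"
    by (simp add: distrib_left sum.distrib sum_distrib_left mult.assoc mult.left_commute)
  also have "?S = 2 * (\<Sum>i<s. \<Sum>j<s. b i * a i j * Q (K i) (K j))"
    by (rule symplectic_double_sum[OF symplectic, symmetric]) (use K sym in auto)
  finally have "Q z1 z1 = Q z z + 2 * \<tau> *
      ((\<Sum>i<s. b i * Q (K i) z) + \<tau> * (\<Sum>i<s. \<Sum>j<s. b i * a i j * Q (K i) (K j)))"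
    by (simp add: algebra_simps)
  also have "(\<Sum>i<s. b i * Q (K i) z) + \<tau> * (\<Sum>i<s. \<Sum>j<s. b i * a i j * Q (K i) (K j)) =
      (\<Sum>i<s. b i * Q (K i) (Z i))"
    by (simp add: Q_Z distrib_left sum.distrib sum_distrib_left mult.assoc mult.left_commute)
  finally show ?thesis .
qed

section \<open>Energy conservation in one step\<close>

text \<open>The values \<open>B (zs i) (es i)\<close> may be any elements of \<open>V\<close>, so the lemma covers the fully implicit
  first step, where they depend on the stages being computed, as well as the later steps, where
  they are extrapolated.\<close>

lemma rk_step_preserves_energy:
  assumes V: "function_subspace V" and cont: "\<And>f. f \<in> V \<Longrightarrow> continuous_on UNIV f"
    and D: "linear_operator_on V D" "skew_adjoint_on V lo hi D"
    and L: "linear_operator_on V L" "symmetric_on V lo hi L"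
    and symplectic: "symplectic_rk s a b"
    and step: "rk_step V lo hi D L B s a b \<tau> z e zs es Z E K M l z1 e1"
    and z: "z \<in> V" and B: "\<And>i. i < s \<Longrightarrow> B (zs i) (es i) \<in> V"
  shows "z1 \<in> V" "discrete_energy lo hi L z1 e1 = discrete_energy lo hi L z e"
proof -
  have ZV: "Z i \<in> V" and Z: "Z i = (\<lambda>x. z x + \<tau> *\<^sub>R (\<Sum>j<s. a i j *\<^sub>R K j x))"
    and K_eq: "K i = D (M i)" and M: "M i = (\<lambda>x. L (Z i) x + B (zs i) (es i) x)"
    and l: "l i = l2 lo hi (B (zs i) (es i)) (K i)" if "i < s" for i
    using step that unfolding rk_step_def by blast+
  have z1: "z1 = (\<lambda>x. z x + \<tau> *\<^sub>R (\<Sum>i<s. b i *\<^sub>R K i x))"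
    and e1: "e1 = exp (ln e + \<tau> * (\<Sum>i<s. b i * l i))"
    using step unfolding rk_step_def by blast+
  have LV: "L f \<in> V" and DV: "D f \<in> V" if "f \<in> V" for f
    using D(1) L(1) that by (auto simp: linear_operator_on_def)
  have MV: "M i \<in> V" if "i < s" for i
    unfolding M[OF that] using that by (intro function_subspace_add[OF V] LV ZV B)
  have KV: "K i \<in> V" if "i < s" for i
    unfolding K_eq[OF that] by (intro DV MV that)
  show "z1 \<in> V"
    unfolding z1 by (intro function_subspace_add_scale[OF V] function_subspace_sum[OF V] z KV) auto
  \<comment> \<open>Orthogonality of \<open>k\<^sub>i = D \<mu>\<^sub>i\<close> and \<open>\<mu>\<^sub>i\<close>, the discrete form of \<open>(D \<mu>, \<mu>) = 0\<close>.\<close>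
  have power: "l2 lo hi (K i) (L (Z i)) = - l i" if "i < s" for i
  proof -
    have "l2 lo hi (K i) (M i) = 0"
      using D(2) MV[OF that] l2_commute[of lo hi "D (M i)" "M i"]
      by (simp add: K_eq[OF that] skew_adjoint_on_def)
    moreover have "l2 lo hi (M i) (K i) = l2 lo hi (L (Z i)) (K i) + l i"
      using l2_add_scale_left[of "L (Z i)" "B (zs i) (es i)" "K i" lo hi 1] that
      by (simp add: M l cont LV ZV B KV)
    ultimately show ?thesis
      by (simp add: l2_commute[of lo hi "K i"])
  qed
  have "l2 lo hi z1 (L z1) =
      l2 lo hi z (L z) + 2 * \<tau> * (\<Sum>i<s. b i * l2 lo hi (K i) (L (Z i)))"
  proof (rule symplectic_rk_quadratic_form[OF V symplectic _ _ z KV ZV Z z1,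
        where Q = "\<lambda>f g. l2 lo hi f (L g)"])
    show "l2 lo hi f (L g) = l2 lo hi g (L f)" if "f \<in> V" "g \<in> V" for f g
      using L(2) that l2_commute[of lo hi "L f" g] by (simp add: symmetric_on_def)
    show "l2 lo hi (\<lambda>x. f x + c *\<^sub>R g x) (L h) = l2 lo hi f (L h) + c * l2 lo hi g (L h)"
      if "f \<in> V" "g \<in> V" "h \<in> V" for f g h c
      using that by (intro l2_add_scale_left cont LV)
  qed
  also have "\<dots> = l2 lo hi z (L z) - 2 * \<tau> * (\<Sum>i<s. b i * l i)"
    by (simp add: power sum_negf)
  finally show "discrete_energy lo hi L z1 e1 = discrete_energy lo hi L z e"
    by (simp add: discrete_energy_def e1 field_simps)
qed

section \<open>Linear implicitness\<close>

lemma linear_operator_on_stage_operator: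
  assumes V: "function_subspace V" and D: "linear_operator_on V D" and L: "linear_operator_on V L"
  shows "linear_operator_on V (stage_operator D L a \<tau> i j)"
proof -
  have DL: "D (L f) \<in> V" "D (L (\<lambda>x. f x + g x)) = (\<lambda>x. D (L f) x + D (L g) x)"
    "D (L (\<lambda>x. c *\<^sub>R f x)) = (\<lambda>x. c *\<^sub>R D (L f) x)" if "f \<in> V" "g \<in> V" for f g c
    using D L that by (auto simp: linear_operator_on_def)
  have "stage_operator D L a \<tau> i j f \<in> V" if "f \<in> V" for f
    using function_subspace_add_scale[OF V, of "if i = j then f else (\<lambda>_. 0)" "D (L f)" "- (\<tau> * a i j)"]
      DL(1)[OF that that] that function_subspace_zero[OF V]
    by (cases "i = j") (simp_all add: stage_operator_def)
  moreover have "stage_operator D L a \<tau> i j (\<lambda>x. f x + g x) =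
      (\<lambda>x. stage_operator D L a \<tau> i j f x + stage_operator D L a \<tau> i j g x)" if "f \<in> V" "g \<in> V" for f g
    using DL(2)[OF that] by (auto simp: stage_operator_def algebra_simps)
  moreover have "stage_operator D L a \<tau> i j (\<lambda>x. c *\<^sub>R f x) =
      (\<lambda>x. c *\<^sub>R stage_operator D L a \<tau> i j f x)" if "f \<in> V" for f c
    using DL(3)[OF that that] by (auto simp: stage_operator_def algebra_simps)
  ultimately show ?thesis by (simp add: linear_operator_on_def)
qed

text \<open>By linearity of \<open>D\<close> the slope splits into a part linear in the unknown stages and a part made of
  known data; moving the first to the left gives the system in the stages alone.\<close>

lemma stage_equation_iff:
  assumes D: "linear_operator_on V D" and L: "linear_operator_on V L" and "i < s"
    and Z: "\<And>j. j < s \<Longrightarrow> Z j \<in> V" and B: "\<And>j. j < s \<Longrightarrow> B (zs j) (es j) \<in> V"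
  shows "(\<lambda>x. \<Sum>j<s. stage_operator D L a \<tau> i j (Z j) x) = stage_rhs D B s a \<tau> z zs es i \<longleftrightarrow>
    Z i = (\<lambda>x. z x + \<tau> *\<^sub>R (\<Sum>j<s. a i j *\<^sub>R explicit_K D L B zs es Z j x))"
proof -
  have K: "explicit_K D L B zs es Z j x = D (L (Z j)) x + D (B (zs j) (es j)) x" if "j < s" for j x
    using D L Z[OF that] B[OF that]
    by (simp add: explicit_K_def explicit_M_def linear_operator_on_def)
  have lhs: "(\<Sum>j<s. stage_operator D L a \<tau> i j (Z j) x) =
      Z i x - \<tau> *\<^sub>R (\<Sum>j<s. a i j *\<^sub>R D (L (Z j)) x)" for x
    using \<open>i < s\<close> by (simp add: stage_operator_def sum_subtractf scaleR_sum_right)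
  have sum_K: "(\<Sum>j<s. a i j *\<^sub>R explicit_K D L B zs es Z j x) =
      (\<Sum>j<s. a i j *\<^sub>R D (L (Z j)) x) + (\<Sum>j<s. a i j *\<^sub>R D (B (zs j) (es j)) x)" for x
    by (simp add: K scaleR_add_right sum.distrib)
  show ?thesis
    unfolding stage_rhs_def fun_eq_iff lhs sum_K scaleR_add_right by (simp add: algebra_simps)
qed

text \<open>Both sides of the required equivalence determine \<open>M\<close>, \<open>K\<close> and \<open>l\<close> by the explicit formulas.  Once
  these are substituted, the two sides differ only in the form of the stage equations.\<close>

lemma linearly_implicit_rk_step:
  assumes V: "function_subspace V" and D: "linear_operator_on V D" and L: "linear_operator_on V L"
    and B: "\<And>z e. z \<in> V \<Longrightarrow> B z e \<in> V"
  shows "linearly_implicit V lo hi D L B s a b \<tau>"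
proof -
  have rhs: "stage_rhs D B s a \<tau> z zs es i \<in> V" if "z \<in> V" "\<forall>i<s. zs i \<in> V" for z zs es i
    unfolding stage_rhs_def
    by (intro function_subspace_add_scale[OF V] function_subspace_sum[OF V])
      (use D that B in \<open>auto simp: linear_operator_on_def\<close>)
  have "rk_step V lo hi D L B s a b \<tau> z e zs es Z E K M l z1 e1 \<longleftrightarrow>
      (\<forall>i<s. Z i \<in> V) \<and>
      (\<forall>i<s. (\<lambda>x. \<Sum>j<s. stage_operator D L a \<tau> i j (Z j) x) = stage_rhs D B s a \<tau> z zs es i) \<and>
      (\<forall>i<s. M i = explicit_M L B zs es Z i \<and> K i = explicit_K D L B zs es Z i \<and>
             l i = explicit_l lo hi D L B zs es Z i \<and>
             E i = exp (ln e + \<tau> * (\<Sum>j<s. a i j * explicit_l lo hi D L B zs es Z j))) \<and>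
      z1 = (\<lambda>x. z x + \<tau> *\<^sub>R (\<Sum>i<s. b i *\<^sub>R explicit_K D L B zs es Z i x)) \<and>
      e1 = exp (ln e + \<tau> * (\<Sum>i<s. b i * explicit_l lo hi D L B zs es Z i))"
    (is "?step \<longleftrightarrow> ?explicit")
    if zs: "\<forall>i<s. zs i \<in> V" for z e zs es Z E K M l z1 e1
  proof -
    have "?step \<longleftrightarrow> ?explicit"
      if M: "\<forall>i<s. M i = explicit_M L B zs es Z i" and K: "\<forall>i<s. K i = explicit_K D L B zs es Z i"
        and l: "\<forall>i<s. l i = explicit_l lo hi D L B zs es Z i" and Z: "\<forall>i<s. Z i \<in> V"
    proof -
      have sum_K: "(\<Sum>i<s. c i *\<^sub>R K i x) = (\<Sum>i<s. c i *\<^sub>R explicit_K D L B zs es Z i x)"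
        and sum_l: "(\<Sum>i<s. c i * l i) = (\<Sum>i<s. c i * explicit_l lo hi D L B zs es Z i)" for c x
        using K l by simp_all
      have "(Z i \<in> V \<and> Z i = (\<lambda>x. z x + \<tau> *\<^sub>R (\<Sum>j<s. a i j *\<^sub>R K j x)) \<and>
           K i = D (M i) \<and> M i = (\<lambda>x. L (Z i) x + B (zs i) (es i) x) \<and>
           E i = exp (ln e + \<tau> * (\<Sum>j<s. a i j * l j)) \<and>
           l i = l2 lo hi (B (zs i) (es i)) (K i)) \<longleftrightarrow>
          (\<lambda>x. \<Sum>j<s. stage_operator D L a \<tau> i j (Z j) x) = stage_rhs D B s a \<tau> z zs es i \<and>
          E i = exp (ln e + \<tau> * (\<Sum>j<s. a i j * explicit_l lo hi D L B zs es Z j))"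
        if "i < s" for i
      proof -
        have "(\<lambda>x. \<Sum>j<s. stage_operator D L a \<tau> i j (Z j) x) = stage_rhs D B s a \<tau> z zs es i \<longleftrightarrow>
            Z i = (\<lambda>x. z x + \<tau> *\<^sub>R (\<Sum>j<s. a i j *\<^sub>R explicit_K D L B zs es Z j x))"
          by (rule stage_equation_iff[OF D L that]) (use Z zs B in auto)
        moreover have "K i = D (M i)" "M i = (\<lambda>x. L (Z i) x + B (zs i) (es i) x)"
          "l i = l2 lo hi (B (zs i) (es i)) (K i)"
          using M K l that by (auto simp: explicit_M_def explicit_K_def explicit_l_def)
        ultimately show ?thesis
          using Z that unfolding sum_K sum_l by blast
      qed
      then have "?step \<longleftrightarrow>
          (\<forall>i<s. (\<lambda>x. \<Sum>j<s. stage_operator D L a \<tau> i j (Z j) x) = stage_rhs D B s a \<tau> z zs es i \<and>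
            E i = exp (ln e + \<tau> * (\<Sum>j<s. a i j * explicit_l lo hi D L B zs es Z j))) \<and>
          z1 = (\<lambda>x. z x + \<tau> *\<^sub>R (\<Sum>i<s. b i *\<^sub>R explicit_K D L B zs es Z i x)) \<and>
          e1 = exp (ln e + \<tau> * (\<Sum>i<s. b i * explicit_l lo hi D L B zs es Z i))"
        unfolding rk_step_def
        by (rule arg_cong2[where f = "(\<and>)", OF all_cong]) (assumption | simp only: sum_K sum_l)+
      then show ?thesis
        using Z M K l by blast
    qed
    moreover have "M i = explicit_M L B zs es Z i \<and> K i = explicit_K D L B zs es Z i \<and>
        l i = explicit_l lo hi D L B zs es Z i \<and> Z i \<in> V" if ?step "i < s" for i
      using that unfolding rk_step_def explicit_M_def explicit_K_def explicit_l_def by metis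
    ultimately show ?thesis by blast
  qed
  with rhs show ?thesis
    unfolding linearly_implicit_def
    by (auto simp only: linear_operator_on_stage_operator[OF V D L])
qed

theorem theorem3p2:
  fixes lo hi :: "'a::euclidean_space"
    and k r :: enat
    and V :: "('a \<Rightarrow> 'b::euclidean_space) set"
    and D L :: "('a \<Rightarrow> 'b) \<Rightarrow> ('a \<Rightarrow> 'b)"
    and N :: "('a \<Rightarrow> 'b) \<Rightarrow> ('a \<Rightarrow> real)"
    and N' :: "('a \<Rightarrow> 'b) \<Rightarrow> ('a \<Rightarrow> 'b)"
    and B :: "('a \<Rightarrow> 'b) \<Rightarrow> real \<Rightarrow> ('a \<Rightarrow> 'b)"
    and s :: nat and a :: "nat \<Rightarrow> nat \<Rightarrow> real" and b :: "nat \<Rightarrow> real"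
    and \<tau> t0 :: real
  assumes cell: "\<forall>i\<in>Basis. lo \<bullet> i < hi \<bullet> i"
    and V: "V = periodic_functions k lo hi"
    and D: "linear_operator_on V D" "skew_adjoint_on V lo hi D"
    and L: "linear_operator_on V L" "symmetric_on V lo hi L" "nonnegative_on V lo hi L"
    and N: "\<forall>z\<in>V. N z \<in> periodic_functions r lo hi"
    and N': "variational_derivative_on V lo hi (H2 lo hi N) N'"
    and B: "B = sav_B lo hi N N'"
    and tau: "\<tau> > 0"
    and symplectic: "symplectic_rk s a b"
    and nodes: "inj_on (rk_c s a) {..<s}" "\<forall>i<s. rk_c s a i \<noteq> 0"
  shows "linearly_implicit V lo hi D L B s a b \<tau> \<and>
         (\<forall>T z e Z E K M l.
           scheme_solution V lo hi D L B s a b \<tau> t0 T z e Z E K M l \<longrightarrow>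
           (\<forall>n<T. discrete_energy lo hi L (z (Suc n)) (e (Suc n)) =
                  discrete_energy lo hi L (z n) (e n)))"
proof -
  have V_sub: "function_subspace V"
    by (simp add: V function_subspace_periodic_functions)
  have cont: "continuous_on UNIV f" if "f \<in> V" for f
    using that by (auto simp: V intro: continuous_periodic_functions)
  have BV: "B w \<epsilon> \<in> V" if "w \<in> V" for w \<epsilon>
    unfolding B sav_B_def
    by (intro function_subspace_scale[OF V_sub])
      (use N' that in \<open>auto simp: variational_derivative_on_def\<close>)
  have "discrete_energy lo hi L (z (Suc n)) (e (Suc n)) = discrete_energy lo hi L (z n) (e n)"
    if sol: "scheme_solution V lo hi D L B s a b \<tau> t0 T z e Z E K M l" and "n < T"
    for T z e Z E K M l n
  proof -
    define zs where "zs n = (if n = 0 then Z 0 else (\<lambda>i x. extrapolate s a \<tau>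
      (t0 + real (n - 1) * \<tau>) (z (n - 1) x) (\<lambda>j. Z (n - 1) j x) i))" for n
    define es where "es n = (if n = 0 then E 0
      else extrapolate s a \<tau> (t0 + real (n - 1) * \<tau>) (e (n - 1)) (E (n - 1)))" for n
    have step: "rk_step V lo hi D L B s a b \<tau> (z n) (e n) (zs n) (es n)
        (Z n) (E n) (K n) (M n) (l n) (z (Suc n)) (e (Suc n))" if "n < T" for n
      using sol that by (simp add: scheme_solution_def zs_def es_def)
    have ZV: "Z n i \<in> V" if "n < T" "i < s" for n i
      using step[OF that(1)] that(2) unfolding rk_step_def by blast
    have zsV: "zs n i \<in> V" if "n < T" "i < s" "n > 0 \<Longrightarrow> z (n - 1) \<in> V" for n i
      using that extrapolate_in_subspace[OF V_sub tau nodes, of "z (n - 1)" "Z (n - 1)"]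
      by (auto simp: zs_def ZV)
    have one_step: "z (Suc n) \<in> V \<and>
        discrete_energy lo hi L (z (Suc n)) (e (Suc n)) = discrete_energy lo hi L (z n) (e n)"
      if "n < T" "z n \<in> V" "n > 0 \<Longrightarrow> z (n - 1) \<in> V" for n
      using rk_step_preserves_energy[OF V_sub cont D L(1,2) symplectic step[OF that(1)] that(2)]
        BV zsV[OF that(1) _ that(3)] by blast
    \<comment> \<open>A step uses the data of the step before it, so the induction has to carry all earlier values.\<close>
    have "\<forall>m\<le>n. z m \<in> V" if "n < T" for n
      using that
    proof (induction n)
      case 0
      then show ?case using sol by (simp add: scheme_solution_def)
    next
      case (Suc n)
      then show ?case using one_step[of n] by (auto simp: le_Suc_eq)
    qed
    then show ?thesis using \<open>n < T\<close> one_step[of n] by auto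
  qed
  then show ?thesis
    using linearly_implicit_rk_step[OF V_sub D(1) L(1), of B] BV by blast
qed

end
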